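(* Every compact subset of a hereditarily normal topological group is metrizable.
   Context: All spaces are assumed to be $T_1$. *)

theory Defs
  imports "HOL-Analysis.Analysis" "HOL-Algebra.Group"
begin

definition topological_group :: "('a, 'b) monoid_scheme \<Rightarrow> 'a topology \<Rightarrow> bool" where
  "topological_group G X \<longleftrightarrow>
     group G \<and> topspace X = carrier G \<and>
     continuous_map (prod_topology X X) X (\<lambda>(x, y). x \<otimes>\<^bsub>G\<^esub> y) \<and>
     continuous_map X X (\<lambda>x. inv\<^bsub>G\<^esub> x)"

end

theory Submission
  imports Defs
begin

text \<open>
  The heart of the proof is a variant of Katetov's theorem on hereditarily normal products. Let
  \<open>d\<close> be a sequence outside a closed subgroup \<open>P\<close> whose set \<open>L\<close> of cluster points lies in
  \<open>P\<close>. The range of \<open>d\<close> and \<open>P - L\<close> are separated, so some open \<open>A\<close> contains the range and has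
  closure disjoint from \<open>P - L\<close>. An element \<open>x\<close> of \<open>P\<close> with \<open>x d\<^sub>n \<in> A\<close> for all \<open>n\<close> then satisfies
  \<open>x L \<subseteq> L\<close>. Hence \<open>L\<close> is invariant under left translation by a closed \<open>G\<^sub>\<delta>\<close> subgroup.

  Applied to a sequence in a translate of an infinite compact set, this yields a compact \<open>G\<^sub>\<delta>\<close>
  subgroup \<open>Q\<close>. If \<open>Q\<close> is finite, the neutral element is a \<open>G\<^sub>\<delta>\<close> point. If \<open>Q\<close> is infinite, Zorn's
  lemma gives a minimal closed subgroup \<open>M\<close> of \<open>Q\<close> admitting a sequence of cosets
  different from \<open>M\<close> that converges to \<open>M\<close>; since such a sequence can be lifted to a smaller subgroup,
  \<open>M\<close> is trivial, so \<open>Q\<close> contains a nontrivial sequence converging to the neutral element. Now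
  \<open>L\<close> consists of the neutral element alone, and the invariance of \<open>L\<close> shows again that the neutral
  element is a \<open>G\<^sub>\<delta>\<close> point. Countably many Urysohn functions then embed every compact set into a
  countable power of the reals.
\<close>

subsection \<open>Cluster points of sequences\<close>

definition cluster_set :: "'a topology \<Rightarrow> (nat \<Rightarrow> 'a) \<Rightarrow> 'a set" where
  "cluster_set X d = (\<Inter>n. X closure_of (d ` {n..}))"

lemma closedin_cluster_set: "closedin X (cluster_set X d)"
  by (auto simp: cluster_set_def)

lemma in_cluster_set_iff:
  "x \<in> cluster_set X d \<longleftrightarrow>
     x \<in> topspace X \<and> (\<forall>U. openin X U \<and> x \<in> U \<longrightarrow> (\<forall>n. \<exists>m\<ge>n. d m \<in> U))"
  unfolding cluster_set_def INT_iff in_closure_of by (simp add: Bex_def) blast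

lemma cluster_set_subset:
  assumes "closedin X C" and "\<And>n. n \<ge> N \<Longrightarrow> d n \<in> C"
  shows "cluster_set X d \<subseteq> C"
proof -
  have "X closure_of (d ` {N..}) \<subseteq> C"
    using assms by (intro closure_of_minimal) auto
  then show ?thesis
    by (auto simp: cluster_set_def)
qed

text \<open>Each tail omits only finitely many terms, and finite sets are closed in a T1 space; so a
  closure point outside the range lies in the closure of every tail.\<close>

lemma closure_of_range_subset:
  assumes "t1_space X" and "range d \<subseteq> topspace X"
  shows "X closure_of (range d) \<subseteq> range d \<union> cluster_set X d"
proof
  fix x
  assume x: "x \<in> X closure_of (range d)"
  have "x \<in> cluster_set X d" if "x \<notin> range d"
    unfolding cluster_set_def
  proof
    fix n
    have "range d = d ` {..<n} \<union> d ` {n..}"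
      by (metis image_Un Compl_lessThan Compl_partition)
    moreover have "closedin X (d ` {..<n})"
      using assms by (auto simp: t1_space_closedin_finite)
    ultimately show "x \<in> X closure_of (d ` {n..})"
      using x that by (auto simp: closure_of_Un closure_of_closedin)
  qed
  then show "x \<in> range d \<union> cluster_set X d"
    by blast
qed

text \<open>Otherwise the closures of the tails minus \<open>U\<close> form a decreasing sequence of
  nonempty closed subsets of \<open>C\<close>; by compactness they share a point, a cluster point
  outside \<open>U\<close>.\<close>

lemma compactin_cluster_set_eventually:
  assumes "compactin X C" "closedin X C" and d: "\<And>n. d n \<in> C"
    and U: "openin X U" "cluster_set X d \<subseteq> U"
  shows "\<exists>N. \<forall>n\<ge>N. d n \<in> U"
proof (rule ccontr)
  assume "\<not> ?thesis"
  then have ex: "\<exists>n\<ge>N. d n \<notin> U" for N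
    by blast
  let ?F = "\<lambda>n. X closure_of (d ` {n..}) - U"
  have "compact_space (subtopology X C)"
    using assms(1) by (rule compact_space_subtopology)
  moreover have sub: "X closure_of (d ` {n..}) \<subseteq> C" for n
    using d by (intro closure_of_minimal assms) auto
  then have "closedin (subtopology X C) (?F n)" for n
    using U(1) sub by (intro closedin_subset_topspace closedin_diff) (auto dest: subsetD[OF sub])
  moreover have "?F n \<noteq> {}" for n
  proof -
    obtain m where "m \<ge> n" "d m \<notin> U"
      using ex by blast
    moreover have "d ` {n..} \<subseteq> X closure_of (d ` {n..})"
      using d closedin_subset[OF assms(2)] by (intro closure_of_subset) auto
    ultimately show ?thesis
      by auto
  qed
  moreover have "decseq ?F"
    by (intro decseq_SucI Diff_mono closure_of_mono image_mono) auto
  ultimately have "(\<Inter>n. ?F n) \<noteq> {}"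
    by (rule compact_space_imp_nest)
  then show False
    using U(2) by (auto simp: cluster_set_def)
qed

lemma cluster_set_nonempty:
  assumes "compactin X C" "closedin X C" "\<And>n. d n \<in> C"
  shows "cluster_set X d \<noteq> {}"
  using compactin_cluster_set_eventually[of X C d "{}"] assms by auto

subsection \<open>Chains of neighbourhoods of the neutral element\<close>

locale hausdorff_group = group G for G (structure) +
  fixes X
  assumes topological_group: "topological_group G X"
    and Hausdorff: "Hausdorff_space X"
begin

lemma topspace_eq: "topspace X = carrier G"
  using topological_group by (simp add: topological_group_def)

lemma t1: "t1_space X"
  using Hausdorff by (rule Hausdorff_imp_t1_space)

lemma continuous_map_group_mult:
  assumes "continuous_map Y X f" "continuous_map Y X g"
  shows "continuous_map Y X (\<lambda>y. f y \<otimes> g y)"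
proof -
  have "continuous_map Y (prod_topology X X) (\<lambda>y. (f y, g y))"
    using assms by (simp add: continuous_map_paired)
  moreover have "continuous_map (prod_topology X X) X (\<lambda>(x, y). x \<otimes> y)"
    using topological_group by (simp add: topological_group_def)
  ultimately have "continuous_map Y X ((\<lambda>(x, y). x \<otimes> y) \<circ> (\<lambda>y. (f y, g y)))"
    by (rule continuous_map_compose)
  then show ?thesis
    by (simp add: o_def)
qed

lemma continuous_map_group_inv: "continuous_map X X (\<lambda>x. inv x)"
  using topological_group by (simp add: topological_group_def)

lemma continuous_map_left_translation: "a \<in> carrier G \<Longrightarrow> continuous_map X X (\<lambda>x. a \<otimes> x)"
  by (intro continuous_map_group_mult) (auto simp: topspace_eq)

lemma continuous_map_right_translation: "a \<in> carrier G \<Longrightarrow> continuous_map X X (\<lambda>x. x \<otimes> a)"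
  by (intro continuous_map_group_mult) (auto simp: topspace_eq)

lemma openin_left_translation_vimage:
  "a \<in> carrier G \<Longrightarrow> openin X U \<Longrightarrow> openin X {x \<in> carrier G. a \<otimes> x \<in> U}"
  using openin_continuous_map_preimage[OF continuous_map_left_translation] by (simp add: topspace_eq)

lemma openin_right_translation_vimage:
  "a \<in> carrier G \<Longrightarrow> openin X U \<Longrightarrow> openin X {x \<in> carrier G. x \<otimes> a \<in> U}"
  using openin_continuous_map_preimage[OF continuous_map_right_translation] by (simp add: topspace_eq)

text \<open>Encodes a closed G_delta subgroup, namely the intersection of the \<open>V n\<close>:
  the product condition makes the intersection closed under products and fits the closure of each
  member into the previous one.\<close>

definition nbhd_chain :: "(nat \<Rightarrow> 'a set) \<Rightarrow> bool" where
  "nbhd_chain V \<longleftrightarrow> (\<forall>n. openin X (V n) \<and> \<one> \<in> V n \<and> (\<forall>x\<in>V n. inv x \<in> V n) \<and>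
     (\<forall>x\<in>V (Suc n). \<forall>y\<in>V (Suc n). x \<otimes> y \<in> V n))"

lemma symmetric_square_nbhd:
  assumes U: "openin X U" "\<one> \<in> U"
  obtains V where "openin X V" "\<one> \<in> V" "\<forall>x\<in>V. inv x \<in> V" "\<forall>x\<in>V. \<forall>y\<in>V. x \<otimes> y \<in> U"
proof -
  define P where "P = {p \<in> topspace (prod_topology X X). (\<lambda>(x, y). x \<otimes> y) p \<in> U}"
  have op: "openin (prod_topology X X) P"
    unfolding P_def using topological_group U(1)
    by (intro openin_continuous_map_preimage[where Y = X]) (simp_all add: topological_group_def)
  have one: "(\<one>, \<one>) \<in> P"
    using U by (simp add: P_def topspace_eq)
  from op[unfolded openin_prod_topology_alt, rule_format, OF one]
  obtain A B where A: "openin X A" "openin X B" "\<one> \<in> A" "\<one> \<in> B" and sub: "A \<times> B \<subseteq> P"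
    by (elim exE conjE) (rule that)
  have "x \<otimes> y \<in> U" if "x \<in> A" "y \<in> B" for x y
    using subsetD[OF sub, of "(x, y)"] that by (simp add: P_def)
  note AB = A this
  let ?W = "A \<inter> B"
  let ?V = "?W \<inter> {x \<in> topspace X. inv x \<in> ?W}"
  have sub: "?W \<subseteq> carrier G"
    using openin_subset[OF AB(1)] by (auto simp: topspace_eq)
  have W: "openin X ?W"
    using AB(1,2) by (rule openin_Int)
  have V: "openin X ?V"
    by (rule openin_Int[OF W openin_continuous_map_preimage[OF continuous_map_group_inv W]])
  show thesis
  proof (rule that[of ?V])
    show "\<one> \<in> ?V"
      using AB(3,4) by (simp add: topspace_eq)
    show "\<forall>x\<in>?V. inv x \<in> ?V"
      using sub by (auto simp: topspace_eq)
    show "\<forall>x\<in>?V. \<forall>y\<in>?V. x \<otimes> y \<in> U"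
      using AB(5) by simp
  qed (use V in auto)
qed

text \<open>The prescription \<open>F n W\<close> may depend on the member \<open>W\<close> just
  built; this lets a chain avoid points chosen from its own earlier members.\<close>

lemma nbhd_chain_refining:
  assumes F: "\<And>n W. openin X W \<Longrightarrow> \<one> \<in> W \<Longrightarrow> openin X (F n W) \<and> \<one> \<in> F n W"
  obtains V where "nbhd_chain V" "V 0 = carrier G" "\<And>n. V (Suc n) \<subseteq> F n (V n)"
proof -
  let ?P = "\<lambda>(n::nat) V. openin X V \<and> \<one> \<in> V \<and> (\<forall>x\<in>V. inv x \<in> V) \<and> (n = 0 \<longrightarrow> V = carrier G)"
  let ?Q = "\<lambda>n V V'. (\<forall>x\<in>V'. \<forall>y\<in>V'. x \<otimes> y \<in> V) \<and> V' \<subseteq> F n V"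
  have "\<exists>V. \<forall>n. ?P n (V n) \<and> ?Q n (V n) (V (Suc n))"
  proof (rule dependent_nat_choice)
    show "\<exists>V. ?P 0 V"
      using openin_topspace[of X] by (intro exI[of _ "carrier G"]) (auto simp: topspace_eq)
  next
    fix V n
    assume V: "?P n V"
    then have FV: "openin X (F n V)" "\<one> \<in> F n V"
      using F by auto
    with V have "openin X (F n V \<inter> V)" "\<one> \<in> F n V \<inter> V"
      by auto
    then obtain W where W: "openin X W" "\<one> \<in> W" "\<forall>x\<in>W. inv x \<in> W"
        "\<forall>x\<in>W. \<forall>y\<in>W. x \<otimes> y \<in> F n V \<inter> V"
      by (rule symmetric_square_nbhd)
    have "W \<subseteq> carrier G"
      using W(1) openin_subset topspace_eq by fastforce
    then have "W \<subseteq> F n V"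
      using W(2,4) by (metis IntD1 r_one subset_eq)
    then show "\<exists>W. ?P (Suc n) W \<and> ?Q n V W"
      using W by (intro exI[of _ W]) auto
  qed
  then obtain V where "\<forall>n. ?P n (V n) \<and> ?Q n (V n) (V (Suc n))"
    by blast
  then show thesis
    by (intro that[of V]) (simp_all add: nbhd_chain_def)
qed

lemma nbhd_chain_below:
  assumes "\<And>n. openin X (U n) \<and> \<one> \<in> U n"
  obtains V where "nbhd_chain V" "V 0 = carrier G" "\<And>n. V (Suc n) \<subseteq> U n"
proof (rule nbhd_chain_refining[of "\<lambda>n W. U n"])
  show "openin X (U n) \<and> \<one> \<in> U n" for n
    by (rule assms)
qed (rule that)

context
  fixes V
  assumes V: "nbhd_chain V"
begin

lemma openin_nbhd_chain: "openin X (V n)"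
  and one_in_nbhd_chain: "\<one> \<in> V n"
  and inv_in_nbhd_chain: "x \<in> V n \<Longrightarrow> inv x \<in> V n"
  and mult_in_nbhd_chain: "x \<in> V (Suc n) \<Longrightarrow> y \<in> V (Suc n) \<Longrightarrow> x \<otimes> y \<in> V n"
  using V by (simp_all add: nbhd_chain_def)

lemma nbhd_chain_subset_carrier: "V n \<subseteq> carrier G"
  using openin_subset[OF openin_nbhd_chain] by (simp add: topspace_eq)

lemma nbhd_chain_Suc_subset: "V (Suc n) \<subseteq> V n"
proof
  fix x
  assume "x \<in> V (Suc n)"
  then show "x \<in> V n"
    using mult_in_nbhd_chain[OF _ one_in_nbhd_chain, of x n] nbhd_chain_subset_carrier[of "Suc n"]
    by auto
qed

lemma nbhd_chain_antimono: "m \<le> n \<Longrightarrow> V n \<subseteq> V m"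
  using nbhd_chain_Suc_subset by (rule lift_Suc_antimono_le)

text \<open>The left translates of \<open>V (Suc n)\<close> by \<open>x\<close> and by
  \<open>a\<close> share some \<open>y\<close>, and \<open>inv a \<otimes> x\<close> is the product
  of \<open>inv a \<otimes> y\<close> and the inverse of \<open>inv x \<otimes> y\<close>, both in
  \<open>V (Suc n)\<close>.\<close>

lemma closure_of_translate_nbhd_chain:
  assumes a: "a \<in> carrier G" and x: "x \<in> X closure_of {x \<in> carrier G. inv a \<otimes> x \<in> V (Suc n)}"
  shows "inv a \<otimes> x \<in> V n"
proof -
  define S where "S = {x \<in> carrier G. inv a \<otimes> x \<in> V (Suc n)}"
  define T where "T = {y \<in> carrier G. inv x \<otimes> y \<in> V (Suc n)}"
  have x: "x \<in> X closure_of S"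
    using x by (simp only: S_def)
  then have xG: "x \<in> carrier G"
    using subsetD[OF closure_of_subset_topspace] topspace_eq by metis
  then have T: "openin X T" "x \<in> T"
    using openin_left_translation_vimage[OF _ openin_nbhd_chain, of "inv x"]
    by (simp_all add: T_def one_in_nbhd_chain)
  then have "T \<inter> S \<noteq> {}"
    using openin_Int_closure_of_eq_empty[OF T(1), of S] x by auto
  then obtain y where y: "y \<in> carrier G" "inv x \<otimes> y \<in> V (Suc n)" "inv a \<otimes> y \<in> V (Suc n)"
    by (auto simp: S_def T_def)
  have "inv a \<otimes> x = (inv a \<otimes> y) \<otimes> inv (inv x \<otimes> y)"
  proof -
    have "y \<otimes> (inv y \<otimes> x) = x"
      using xG y(1) m_assoc[of y "inv y" x] by simp
    then show ?thesis
      using a xG y(1) by (simp add: inv_mult_group m_assoc)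
  qed
  then show ?thesis
    using mult_in_nbhd_chain[OF y(3) inv_in_nbhd_chain[OF y(2)]] by simp
qed

lemma closure_of_nbhd_chain: "X closure_of V (Suc n) \<subseteq> V n"
proof
  fix x
  assume x: "x \<in> X closure_of V (Suc n)"
  then have "x \<in> carrier G"
    using subsetD[OF closure_of_subset_topspace] topspace_eq by metis
  moreover have "{x \<in> carrier G. inv \<one> \<otimes> x \<in> V (Suc n)} = V (Suc n)"
    using nbhd_chain_subset_carrier l_one by (force simp: inv_one)
  ultimately show "x \<in> V n"
    using closure_of_translate_nbhd_chain[of \<one> x n] x by simp
qed

lemma closedin_nbhd_chain_Inter: "closedin X (\<Inter>n. V n)"
proof -
  have "X closure_of (\<Inter>n. V n) \<subseteq> V n" for n
  proof -
    have "X closure_of (\<Inter>n. V n) \<subseteq> X closure_of V (Suc n)"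
      by (rule closure_of_mono) auto
    then show ?thesis
      using closure_of_nbhd_chain by (rule order_trans)
  qed
  then have "X closure_of (\<Inter>n. V n) \<subseteq> (\<Inter>n. V n)"
    by (rule INT_greatest)
  moreover have "(\<Inter>n. V n) \<subseteq> topspace X"
    using openin_subset[OF openin_nbhd_chain, of 0] by auto
  ultimately show ?thesis
    using closure_of_subset_eq[of "\<Inter>n. V n" X] by simp
qed

lemma subgroup_nbhd_chain_Inter: "subgroup (\<Inter>n. V n) G"
proof (rule subgroup.intro)
  show "(\<Inter>n. V n) \<subseteq> carrier G"
    using nbhd_chain_subset_carrier[of 0] by auto
qed (simp_all add: one_in_nbhd_chain inv_in_nbhd_chain mult_in_nbhd_chain)

text \<open>A tail inside \<open>V (Suc k)\<close> has its closure inside \<open>V k\<close>; the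
  lost level is harmless because \<open>k\<close> is arbitrary.\<close>

lemma cluster_set_subset_nbhd_chain_Inter:
  assumes "\<And>k. \<exists>N. \<forall>n\<ge>N. d n \<in> V k"
  shows "cluster_set X d \<subseteq> (\<Inter>k. V k)"
proof
  fix x
  assume x: "x \<in> cluster_set X d"
  have "x \<in> V k" for k
  proof -
    obtain N where "\<forall>n\<ge>N. d n \<in> V (Suc k)"
      using assms by blast
    then have "d n \<in> X closure_of V (Suc k)" if "n \<ge> N" for n
      using that closure_of_subset[OF openin_subset[OF openin_nbhd_chain, of "Suc k"]] by auto
    then show ?thesis
      using cluster_set_subset[of X _ N d, OF closedin_closure_of] x closure_of_nbhd_chain[of k] by auto
  qed
  then show "x \<in> (\<Inter>k. V k)"
    by blast
qed

end

subsection \<open>Katetov-type invariance of cluster sets\<close>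

text \<open>Hereditary normality supplies the open sets \<open>A\<close> and \<open>B\<close>. The
  admissible translations are described by countably many neighbourhoods \<open>U n\<close> of
  \<open>\<one>\<close>, so that a chain can be placed below them.\<close>

lemma translates_of_cluster_set:
  assumes hn: "hereditarily normal_space X"
    and P: "subgroup P G" "closedin X P"
    and d: "\<And>n. d n \<in> carrier G - P"
    and sub: "cluster_set X d \<subseteq> P"
  obtains U :: "nat \<Rightarrow> 'a set" where "\<And>n. openin X (U n) \<and> \<one> \<in> U n"
    "\<And>x l. x \<in> P \<inter> (\<Inter>n. U n) \<Longrightarrow> l \<in> cluster_set X d \<Longrightarrow> x \<otimes> l \<in> cluster_set X d"
proof -
  let ?L = "cluster_set X d"
  have PG: "P \<subseteq> carrier G"
    using P(1) by (rule subgroup.subset)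
  have dG: "range d \<subseteq> topspace X"
    using d by (auto simp: topspace_eq)
  \<comment> \<open>Separatedness: the closed set \<open>P\<close> misses the range of
    \<open>d\<close>, and the closure of the range adds only points of \<open>?L\<close>.\<close>
  have "X closure_of (P - ?L) \<subseteq> P"
    using P(2) by (intro closure_of_minimal) auto
  moreover have "X closure_of (range d) \<subseteq> range d \<union> ?L"
    using t1 dG by (rule closure_of_range_subset)
  ultimately have "separatedin X (range d) (P - ?L)"
    unfolding separatedin_def using dG PG d by (auto simp: topspace_eq)
  then obtain A B where AB: "openin X A" "openin X B" "range d \<subseteq> A" "P - ?L \<subseteq> B" "disjnt A B"
    using hn unfolding hereditarily_normal_separation by metis
  define U where "U n = {x \<in> carrier G. x \<otimes> d n \<in> A}" for n
  show thesis
  proof (rule that[of U])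
    fix n
    show "openin X (U n) \<and> \<one> \<in> U n"
      unfolding U_def using d[of n] AB(1,3) openin_right_translation_vimage by auto
  next
    fix x l
    assume "x \<in> P \<inter> (\<Inter>n. U n)" and l: "l \<in> ?L"
    then have x: "x \<in> P" "\<And>n. x \<in> U n"
      by auto
    have xl: "x \<otimes> l \<in> P"
      using P(1) x(1) l sub by (auto intro: subgroup.m_closed)
    show "x \<otimes> l \<in> ?L"
    proof (rule ccontr)
      assume "x \<otimes> l \<notin> ?L"
      with xl AB(4) have "x \<otimes> l \<in> B"
        by auto
      \<comment> \<open>Near \<open>l\<close> there is a term \<open>d m\<close> with
        \<open>x \<otimes> d m \<in> B\<close>, whereas \<open>x \<in> U m\<close> puts the same
        product into \<open>A\<close>.\<close>
      define T where "T = {y \<in> carrier G. x \<otimes> y \<in> B}"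
      have "openin X T" "l \<in> T"
        using openin_left_translation_vimage[OF _ AB(2), of x] x(1) PG l sub \<open>x \<otimes> l \<in> B\<close>
        by (auto simp: T_def)
      then obtain m where "d m \<in> T"
        using l unfolding in_cluster_set_iff by blast
      then show False
        using x(2)[of m] AB(5) by (auto simp: T_def U_def disjnt_iff)
    qed
  qed
qed

section \<open>Accumulation at the neutral element and a compact G_delta subgroup\<close>

lemma infinite_compact_accumulation:
  assumes "compactin X K" "infinite K"
  obtains c where "c \<in> K"
    "\<And>U. openin X U \<Longrightarrow> \<one> \<in> U \<Longrightarrow> \<exists>x\<in>(\<lambda>k. inv c \<otimes> k) ` K. x \<noteq> \<one> \<and> x \<in> U"
proof -
  have "K \<inter> X derived_set_of K \<noteq> {}"
    using compactin_imp_Bolzano_Weierstrass[OF assms(1), of K] assms(2) by blast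
  then obtain c where c: "c \<in> K" "c \<in> X derived_set_of K"
    by blast
  have KG: "K \<subseteq> carrier G"
    using compactin_subset_topspace[OF assms(1)] topspace_eq by simp
  then have cG: "c \<in> carrier G"
    using c by auto
  show thesis
  proof (rule that[OF c(1)])
    fix U
    assume U: "openin X U" "\<one> \<in> U"
    \<comment> \<open>Left translation by \<open>inv c\<close> carries the accumulation point
      \<open>c\<close> of \<open>K\<close> to \<open>\<one>\<close>.\<close>
    define T where "T = {y \<in> carrier G. inv c \<otimes> y \<in> U}"
    have "openin X T" "c \<in> T"
      using openin_left_translation_vimage[OF _ U(1), of "inv c"] cG U(2) by (auto simp: T_def)
    then obtain k where k: "k \<noteq> c" "k \<in> K" "k \<in> T"
      using c(2) unfolding in_derived_set_of by metis
    have "inv c \<otimes> k \<noteq> \<one>"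
      using k(1,2) cG KG by (metis inv_closed inv_equality inv_inv subsetD)
    then show "\<exists>x\<in>(\<lambda>k. inv c \<otimes> k) ` K. x \<noteq> \<one> \<and> x \<in> U"
      using k by (auto simp: T_def)
  qed
qed

text \<open>The point \<open>\<delta> U\<close> depends only on the open set \<open>U\<close>, so
  \<open>V (Suc n)\<close> can omit the point chosen in \<open>V n\<close>. The sequence is then
  eventually in every \<open>V k\<close> but never in their intersection.\<close>

lemma nbhd_chain_sequence:
  assumes "\<And>U. openin X U \<Longrightarrow> \<one> \<in> U \<Longrightarrow> \<exists>x\<in>C. x \<noteq> \<one> \<and> x \<in> U"
  obtains V d where "nbhd_chain V" "\<And>n. d n \<in> C" "\<And>n. d n \<in> V n" "\<And>n. d n \<notin> V (Suc n)"
proof -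
  define \<delta> where "\<delta> U = (SOME x. x \<in> C \<and> x \<noteq> \<one> \<and> x \<in> U)" for U
  have \<delta>: "\<delta> U \<in> C \<and> \<delta> U \<noteq> \<one> \<and> \<delta> U \<in> U" if "openin X U" "\<one> \<in> U" for U
    unfolding \<delta>_def by (rule someI_ex) (use assms[OF that] in blast)
  obtain V where V: "nbhd_chain V" "\<And>n. V (Suc n) \<subseteq> V n - {\<delta> (V n)}"
  proof (rule nbhd_chain_refining[of "\<lambda>n W. W - {\<delta> W}"])
    fix W assume W: "openin X W" "\<one> \<in> W"
    then show "openin X (W - {\<delta> W}) \<and> \<one> \<in> W - {\<delta> W}"
      using \<delta>[OF W] t1 t1_space_openin_delete_alt[of X] by auto
  qed (rule that)
  show thesis
  proof (rule that[of V "\<lambda>n. \<delta> (V n)"])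
    fix n
    note \<delta>[OF openin_nbhd_chain[OF V(1)] one_in_nbhd_chain[OF V(1)], of n]
    then show "\<delta> (V n) \<in> C" "\<delta> (V n) \<in> V n" "\<delta> (V n) \<notin> V (Suc n)"
      using V(2)[of n] by auto
  qed (rule V(1))
qed

lemma compact_nbhd_chain_Inter:
  assumes hn: "hereditarily normal_space X" and K: "compactin X K" "infinite K"
  obtains V where "nbhd_chain V" "compactin X (\<Inter>n. V n)"
proof -
  obtain c where c: "c \<in> K"
    and acc: "\<And>U. openin X U \<Longrightarrow> \<one> \<in> U \<Longrightarrow> \<exists>x\<in>(\<lambda>k. inv c \<otimes> k) ` K. x \<noteq> \<one> \<and> x \<in> U"
    using infinite_compact_accumulation[OF K] by blast
  have cG: "c \<in> carrier G"
    using c compactin_subset_topspace[OF K(1)] topspace_eq by auto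
  define C where "C = (\<lambda>k. inv c \<otimes> k) ` K"
  have C: "compactin X C"
    unfolding C_def
    by (rule image_compactin[OF K(1) continuous_map_left_translation[OF inv_closed[OF cG]]])
  then have Ccl: "closedin X C"
    using Hausdorff by (rule compactin_imp_closedin[rotated])
  obtain V d where V: "nbhd_chain V" and d: "\<And>n. d n \<in> C" "\<And>n. d n \<in> V n" "\<And>n. d n \<notin> V (Suc n)"
    using nbhd_chain_sequence[of C] acc unfolding C_def by blast
  define P where "P = (\<Inter>n. V n)"
  have P: "subgroup P G" "closedin X P"
    unfolding P_def using subgroup_nbhd_chain_Inter[OF V] closedin_nbhd_chain_Inter[OF V] .
  let ?L = "cluster_set X d"
  have "\<exists>N. \<forall>n\<ge>N. d n \<in> V k" for k
    using nbhd_chain_antimono[OF V] d(2) by blast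
  then have LP: "?L \<subseteq> P"
    unfolding P_def by (rule cluster_set_subset_nbhd_chain_Inter[OF V])
  have LC: "?L \<subseteq> C"
    using Ccl d(1) by (rule cluster_set_subset)
  have dP: "d n \<in> carrier G - P" for n
    using d(2,3)[of n] nbhd_chain_subset_carrier[OF V, of n] by (auto simp: P_def)
  obtain U :: "nat \<Rightarrow> 'a set" where U: "\<And>n. openin X (U n) \<and> \<one> \<in> U n"
    and UL: "\<And>x l. x \<in> P \<inter> (\<Inter>n. U n) \<Longrightarrow> l \<in> ?L \<Longrightarrow> x \<otimes> l \<in> ?L"
    by (rule translates_of_cluster_set[OF hn P dP LP]) (rule that)
  obtain l where l: "l \<in> ?L"
    using cluster_set_nonempty[of X C d, OF C Ccl d(1)] by blast
  then have lG: "l \<in> carrier G"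
    using closedin_subset[OF Ccl] LC topspace_eq by auto
  obtain V' where V': "nbhd_chain V'" "\<And>n. V' (Suc n) \<subseteq> V n \<inter> U n"
  proof (rule nbhd_chain_below[of "\<lambda>n. V n \<inter> U n"])
    fix n
    show "openin X (V n \<inter> U n) \<and> \<one> \<in> V n \<inter> U n"
      using U openin_nbhd_chain[OF V] one_in_nbhd_chain[OF V] by auto
  qed (rule that)
  let ?Q = "\<Inter>n. V' n"
  \<comment> \<open>Invariance gives \<open>x \<otimes> l \<in> ?L\<close> for every
    \<open>x\<close> in \<open>?Q\<close>, so \<open>?Q\<close> is a closed subset of a right
    translate of the compact set \<open>?L\<close>.\<close>
  have "?Q \<subseteq> (\<lambda>x. x \<otimes> inv l) ` ?L"
  proof
    fix x
    assume x: "x \<in> ?Q"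
    then have x': "x \<in> V n" "x \<in> U n" for n
      using V'(2)[of n] by auto
    then have "x \<in> P \<inter> (\<Inter>n. U n)" "x \<in> carrier G"
      using nbhd_chain_subset_carrier[OF V] by (auto simp: P_def)
    then have "x \<otimes> l \<in> ?L" "x \<in> carrier G"
      using UL[OF _ l] by auto
    then show "x \<in> (\<lambda>x. x \<otimes> inv l) ` ?L"
      using lG by (intro image_eqI[of _ _ "x \<otimes> l"]) (simp_all add: m_assoc)
  qed
  moreover have "compactin X ?L"
    using C LC closedin_cluster_set by (rule closed_compactin)
  then have "compactin X ((\<lambda>x. x \<otimes> inv l) ` ?L)"
    by (rule image_compactin[OF _ continuous_map_right_translation[OF inv_closed[OF lG]]])
  ultimately have "compactin X ?Q"
    using closedin_nbhd_chain_Inter[OF V'(1)] closed_compactin by blast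
  then show thesis
    using V'(1) that by blast
qed

subsection \<open>Convergent sequences in infinite compact groups\<close>

text \<open>
  \<open>E 0\<close> is the subgroup \<open>M\<close> of the Zorn argument and \<open>E (Suc n)\<close> is the \<open>n\<close>-th term of the sequence of
  cosets, required only to be a union of cosets of \<open>M\<close>. Convergence to \<open>M\<close> is expressed
  by cluster points of selections, a condition that passes to intersections of chains.
\<close>
definition coset_sequence :: "'a set \<Rightarrow> (nat \<Rightarrow> 'a set) \<Rightarrow> bool" where
  "coset_sequence Q E \<longleftrightarrow> subgroup (E 0) G \<and>
     (\<forall>n. closedin X (E n) \<and> E n \<noteq> {} \<and> E n \<subseteq> Q) \<and>
     (\<forall>n. \<forall>x\<in>E (Suc n). \<forall>m\<in>E 0. x \<otimes> m \<in> E (Suc n)) \<and>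
     (\<forall>n. E (Suc n) \<inter> E 0 = {}) \<and>
     (\<forall>d. (\<forall>n. d n \<in> E (Suc n)) \<longrightarrow> cluster_set X d \<subseteq> E 0)"

text \<open>Serves both the start and the descent of the Zorn argument: right invariance of
  \<open>W n\<close> under \<open>M\<close> keeps the new cosets inside \<open>W n\<close>. Only the
  smaller subgroup must omit \<open>d n\<close>, since at the start \<open>W n\<close> and
  \<open>M\<close> are both \<open>Q\<close>.\<close>

lemma coset_sequence_refinement:
  assumes Q: "compactin X Q"
    and M: "subgroup M G" "closedin X M" "M \<subseteq> Q"
    and W: "\<And>n. W n \<subseteq> Q" "\<And>n x m. x \<in> W n \<Longrightarrow> m \<in> M \<Longrightarrow> x \<otimes> m \<in> W n"
      "\<And>d. (\<And>n. d n \<in> W n) \<Longrightarrow> cluster_set X d \<subseteq> M"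
    and V: "nbhd_chain V"
    and d: "\<And>n. d n \<in> W n" "\<And>k. \<exists>N. \<forall>n\<ge>N. d n \<in> V k"
      "\<And>n. d n \<notin> M \<inter> (\<Inter>k. V k)"
  shows "coset_sequence Q
    (case_nat (M \<inter> (\<Inter>k. V k)) (\<lambda>n. (\<lambda>m. d n \<otimes> m) ` (M \<inter> (\<Inter>k. V k))))"
proof -
  define M' where "M' = M \<inter> (\<Inter>k. V k)"
  have sub': "subgroup M' G"
    unfolding M'_def using M(1) subgroup_nbhd_chain_Inter[OF V] by (rule subgroups_Inter_pair)
  have QG: "Q \<subseteq> carrier G"
    using compactin_subset_topspace[OF Q] by (simp add: topspace_eq)
  have dG: "d n \<in> carrier G" for n
    using W(1)[of n] d(1)[of n] QG by blast
  have M'G: "M' \<subseteq> carrier G"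
    using sub' by (rule subgroup.subset)
  have cl': "closedin X M'"
    unfolding M'_def using M(2) closedin_nbhd_chain_Inter[OF V] by (rule closedin_Int)
  have M'Q: "M' \<subseteq> Q"
    using M(3) by (auto simp: M'_def)
  have comp': "compactin X M'"
    using Q M'Q cl' by (rule closed_compactin)
  define E where "E = case_nat M' (\<lambda>n. (\<lambda>m. d n \<otimes> m) ` M')"
  have E0: "E 0 = M'" and ES: "E (Suc n) = (\<lambda>m. d n \<otimes> m) ` M'" for n
    by (simp_all add: E_def)
  have ESW: "E (Suc n) \<subseteq> W n" for n
    using W(2)[OF d(1)] by (auto simp: ES M'_def)
  have "closedin X (E n) \<and> E n \<noteq> {} \<and> E n \<subseteq> Q" for n
  proof (cases n)
    case 0
    then show ?thesis
      using cl' M'Q subgroup.one_closed[OF sub'] by (auto simp: E0)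
  next
    case (Suc k)
    have "compactin X ((\<lambda>m. d k \<otimes> m) ` M')"
      by (rule image_compactin[OF comp' continuous_map_left_translation[OF dG]])
    then have "closedin X ((\<lambda>m. d k \<otimes> m) ` M')"
      using Hausdorff compactin_imp_closedin by blast
    then show ?thesis
      using ESW[of k] W(1)[of k] subgroup.one_closed[OF sub'] by (auto simp: Suc ES)
  qed
  moreover have "x \<otimes> m \<in> E (Suc n)" if xm: "x \<in> E (Suc n)" "m \<in> E 0" for x m n
  proof -
    obtain y where y: "y \<in> M'" "x = d n \<otimes> y"
      using xm by (auto simp: ES)
    then have "x \<otimes> m = d n \<otimes> (y \<otimes> m)"
      using xm M'G dG by (auto simp: E0 intro!: m_assoc)
    then show ?thesis
      using y xm subgroup.m_closed[OF sub'] by (auto simp: E0 ES)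
  qed
  moreover have "E (Suc n) \<inter> E 0 = {}" for n
  proof -
    have "d n \<in> M'" if m: "m \<in> M'" "d n \<otimes> m \<in> M'" for m
    proof -
      have "d n = (d n \<otimes> m) \<otimes> inv m"
        using m M'G dG by (auto simp: m_assoc subset_iff)
      also have "\<dots> \<in> M'"
        by (rule subgroup.m_closed[OF sub' m(2) subgroup.m_inv_closed[OF sub' m(1)]])
      finally show ?thesis .
    qed
    then show ?thesis
      using d(3)[of n] by (auto simp: E0 ES M'_def)
  qed
  \<comment> \<open>A selection from the cosets is one from the sets \<open>W n\<close>, so it
    clusters in \<open>M\<close>; it is also eventually in each \<open>V k\<close>, being the
    product of \<open>d n\<close> and an element of \<open>V (Suc k)\<close>.\<close>
  moreover have "cluster_set X e \<subseteq> E 0" if e: "\<forall>n. e n \<in> E (Suc n)" for e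
  proof -
    have "cluster_set X e \<subseteq> M"
      by (rule W(3)) (use e ESW in blast)
    moreover have "\<exists>N. \<forall>n\<ge>N. e n \<in> V k" for k
    proof -
      obtain N where N: "\<forall>n\<ge>N. d n \<in> V (Suc k)"
        using d(2) by blast
      have "e n \<in> V k" if "n \<ge> N" for n
      proof -
        obtain m where m: "m \<in> M'" "e n = d n \<otimes> m"
          using e[rule_format, of n] by (auto simp: ES)
        have "m \<in> V (Suc k)"
          using m(1) by (auto simp: M'_def)
        then show ?thesis
          using N that m(2) mult_in_nbhd_chain[OF V] by simp
      qed
      then show ?thesis
        by blast
    qed
    then have "cluster_set X e \<subseteq> (\<Inter>k. V k)"
      by (rule cluster_set_subset_nbhd_chain_Inter[OF V])
    ultimately show ?thesis
      unfolding E0 M'_def by simp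
  qed
  ultimately have "coset_sequence Q E"
    unfolding coset_sequence_def using sub' E0 by simp
  then show ?thesis
    unfolding E_def M'_def .
qed

text \<open>The starting point for Zorn's lemma refines \<open>Q\<close> itself. Translating by the
  inverse of \<open>c \<in> Q\<close> does not leave the subgroup \<open>Q\<close>, so
  \<open>Q\<close> accumulates at \<open>\<one>\<close>.\<close>

lemma coset_sequence_exists:
  assumes Q: "compactin X Q" "subgroup Q G" "infinite Q"
  shows "\<exists>E. coset_sequence Q E"
proof -
  obtain c where c: "c \<in> Q"
    and acc: "\<And>U. openin X U \<Longrightarrow> \<one> \<in> U \<Longrightarrow> \<exists>x\<in>(\<lambda>k. inv c \<otimes> k) ` Q. x \<noteq> \<one> \<and> x \<in> U"
    using infinite_compact_accumulation[OF Q(1,3)] by blast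
  have "(\<lambda>k. inv c \<otimes> k) ` Q \<subseteq> Q"
    using c Q(2) by (auto intro: subgroup.m_closed subgroup.m_inv_closed)
  then have "\<exists>x\<in>Q. x \<noteq> \<one> \<and> x \<in> U" if "openin X U" "\<one> \<in> U" for U
    using acc[OF that] by blast
  then obtain V d where V: "nbhd_chain V"
    and d: "\<And>n. d n \<in> Q" "\<And>n. d n \<in> V n" "\<And>n. d n \<notin> V (Suc n)"
    using nbhd_chain_sequence[of Q] by blast
  have Qcl: "closedin X Q"
    using Q(1) Hausdorff compactin_imp_closedin by blast
  have "coset_sequence Q (case_nat (Q \<inter> (\<Inter>k. V k)) (\<lambda>n. (\<lambda>m. d n \<otimes> m) ` (Q \<inter> (\<Inter>k. V k))))"
  proof (rule coset_sequence_refinement[where W = "\<lambda>n. Q"])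
    show "cluster_set X e \<subseteq> Q" if "\<And>n::nat. e n \<in> Q" for e
      using Qcl that by (rule cluster_set_subset)
    show "\<exists>N. \<forall>n\<ge>N. d n \<in> V k" for k
      using nbhd_chain_antimono[OF V] d(2) by blast
    show "d n \<notin> Q \<inter> (\<Inter>k. V k)" for n
      using d(3) by blast
  qed (use Q Qcl V d subgroup.m_closed[OF Q(2)] in auto)
  then show ?thesis
    by blast
qed

text \<open>Provides the bounds for Zorn's lemma. Compactness of \<open>Q\<close> keeps the
  intersections nonempty, and a selection from the intersections is a selection from every member of
  the chain.\<close>

lemma coset_sequence_Inter:
  assumes Q: "compactin X Q" and "C \<noteq> {}" and C: "\<And>E. E \<in> C \<Longrightarrow> coset_sequence Q E"
    and chain: "\<And>E E'. E \<in> C \<Longrightarrow> E' \<in> C \<Longrightarrow> E \<le> E' \<or> E' \<le> E"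
  shows "coset_sequence Q (\<lambda>n. \<Inter>E\<in>C. E n)"
proof -
  obtain E0 where E0: "E0 \<in> C"
    using \<open>C \<noteq> {}\<close> by blast
  have C1: "subgroup (E 0) G" and C2: "closedin X (E n)" "E n \<noteq> {}" "E n \<subseteq> Q"
    and C3: "x \<in> E (Suc n) \<Longrightarrow> m \<in> E 0 \<Longrightarrow> x \<otimes> m \<in> E (Suc n)"
    and C4: "E (Suc n) \<inter> E 0 = {}"
    and C5: "(\<And>n. d n \<in> E (Suc n)) \<Longrightarrow> cluster_set X d \<subseteq> E 0"
    if "E \<in> C" for E n x m d
    using C[OF that] by (auto simp: coset_sequence_def)
  have ne: "(\<Inter>E\<in>C. E n) \<noteq> {}" for n
  proof -
    have "Q \<inter> \<Inter>\<F> \<noteq> {}" if \<F>: "finite \<F>" "\<F> \<subseteq> (\<lambda>E. E n) ` C" for \<F>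
    proof -
      obtain D where D: "D \<subseteq> C" "finite D" "\<F> = (\<lambda>E. E n) ` D"
        using finite_subset_image[OF \<F>] by blast
      \<comment> \<open>A minimal element of a finite subset of a chain is its least element, so its
        \<open>n\<close>-th set lies below the whole family; inserting \<open>E0\<close> covers the
        empty family.\<close>
      have "finite (insert E0 D)" "insert E0 D \<noteq> {}"
        using D by auto
      then obtain m where m: "m \<in> insert E0 D" "\<And>E. E \<in> insert E0 D \<Longrightarrow> E \<le> m \<Longrightarrow> m = E"
        using finite_has_minimal[of "insert E0 D"] by blast
      have mC: "m \<in> C"
        using m(1) D(1) E0 by auto
      have "m \<le> E" if "E \<in> D" for E
        using chain[OF mC, of E] m(2)[of E] that D(1) by auto
      then have "m n \<subseteq> Q \<inter> \<Inter>\<F>"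
        using C2(3)[OF mC] by (auto simp: D(3) le_fun_def)
      then show ?thesis
        using C2(2)[OF mC] by blast
    qed
    then have fip: "\<forall>\<F>. finite \<F> \<and> \<F> \<subseteq> (\<lambda>E. E n) ` C \<longrightarrow> Q \<inter> \<Inter>\<F> \<noteq> {}"
      by (intro allI impI) (elim conjE)
    have cl: "\<forall>A\<in>(\<lambda>E. E n) ` C. closedin X A"
      using C2(1) by blast
    from Q have fipQ: "\<forall>\<U>. (\<forall>A\<in>\<U>. closedin X A) \<and>
        (\<forall>\<F>. finite \<F> \<and> \<F> \<subseteq> \<U> \<longrightarrow> Q \<inter> \<Inter>\<F> \<noteq> {}) \<longrightarrow> Q \<inter> \<Inter>\<U> \<noteq> {}"
      unfolding compactin_fip by (rule conjunct2)
    have "Q \<inter> \<Inter>((\<lambda>E. E n) ` C) \<noteq> {}"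
      by (rule mp[OF spec[OF fipQ] conjI[OF cl fip]])
    then show ?thesis
      by blast
  qed
  show ?thesis
    unfolding coset_sequence_def
  proof (intro conjI allI ballI impI)
    show "subgroup (\<Inter>E\<in>C. E 0) G"
      using subgroups_Inter[of "(\<lambda>E. E 0) ` C"] C1 E0 by blast
    show "closedin X (\<Inter>E\<in>C. E n)" for n
      using E0 C2(1) by (intro closedin_Inter) auto
    show "(\<Inter>E\<in>C. E n) \<noteq> {}" for n
      by (rule ne)
    show "(\<Inter>E\<in>C. E n) \<subseteq> Q" for n
      using C2(3)[OF E0] E0 by blast
    show "x \<otimes> m \<in> (\<Inter>E\<in>C. E (Suc n))"
      if "x \<in> (\<Inter>E\<in>C. E (Suc n))" "m \<in> (\<Inter>E\<in>C. E 0)" for n x m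
      using that C3 by blast
    show "(\<Inter>E\<in>C. E (Suc n)) \<inter> (\<Inter>E\<in>C. E 0) = {}" for n
      using C4[OF E0, of n] E0 by blast
    show "cluster_set X d \<subseteq> (\<Inter>E\<in>C. E 0)" if "\<forall>n. d n \<in> (\<Inter>E\<in>C. E (Suc n))" for d
      using that C5 by blast
  qed
qed

text \<open>The right translates of \<open>U\<close> by elements of \<open>E 0\<close> form an open
  set \<open>T\<close> around \<open>E 0\<close>, which eventually contains any selection. Right
  invariance of \<open>E (Suc n)\<close> under \<open>E 0\<close> then moves the selected point into
  \<open>U\<close>.\<close>

lemma coset_sequence_meets_nbhd:
  assumes Q: "compactin X Q" and E: "coset_sequence Q E" and U: "openin X U" "\<one> \<in> U"
  shows "\<exists>N. \<forall>n\<ge>N. E (Suc n) \<inter> U \<noteq> {}"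
proof -
  have sub: "subgroup (E 0) G" and E2: "\<And>n. E n \<noteq> {}" "\<And>n. E n \<subseteq> Q"
    and E3: "\<And>n x m. x \<in> E (Suc n) \<Longrightarrow> m \<in> E 0 \<Longrightarrow> x \<otimes> m \<in> E (Suc n)"
    and E5: "\<And>d. (\<And>n. d n \<in> E (Suc n)) \<Longrightarrow> cluster_set X d \<subseteq> E 0"
    using E by (auto simp: coset_sequence_def)
  have "\<forall>n. \<exists>x. x \<in> E (Suc n)"
    using E2(1) by blast
  then obtain e where e: "\<And>n. e n \<in> E (Suc n)"
    by metis
  have M: "E 0 \<subseteq> carrier G"
    using sub by (rule subgroup.subset)
  define T where "T = (\<Union>m\<in>E 0. {y \<in> carrier G. y \<otimes> inv m \<in> U})"
  have "openin X T"
    unfolding T_def using M U(1) by (auto intro!: openin_Union openin_right_translation_vimage)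
  moreover have "E 0 \<subseteq> T"
    using M U(2) by (force simp: T_def)
  then have "cluster_set X e \<subseteq> T"
    using E5[of e] e by blast
  moreover have "e n \<in> Q" for n
    using e E2(2) by blast
  ultimately obtain N where N: "\<forall>n\<ge>N. e n \<in> T"
    using compactin_cluster_set_eventually[of X Q e T] Q Hausdorff compactin_imp_closedin by blast
  have "E (Suc n) \<inter> U \<noteq> {}" if n: "n \<ge> N" for n
  proof -
    obtain m where "m \<in> E 0" "e n \<otimes> inv m \<in> U"
      using N n by (auto simp: T_def)
    then show ?thesis
      using E3[OF e, of "inv m" n] subgroup.m_inv_closed[OF sub] by blast
  qed
  then show ?thesis
    by blast
qed

text \<open>Cutting \<open>E 0\<close> down by a chain that omits \<open>x\<close> gives the smaller
  subgroup; the sequence lifts to it because representatives \<open>d n \<in> E (Suc n)\<close> can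
  be chosen eventually inside every member of the chain.\<close>

lemma coset_sequence_not_minimal:
  assumes Q: "compactin X Q" and E: "coset_sequence Q E" and x: "x \<in> E 0" "x \<noteq> \<one>"
  obtains E' where "coset_sequence Q E'" "E' \<le> E" "x \<notin> E' 0"
proof -
  have sub: "subgroup (E 0) G" and E2: "\<And>n. closedin X (E n)" "\<And>n. E n \<noteq> {}" "\<And>n. E n \<subseteq> Q"
    and E3: "\<And>n x m. x \<in> E (Suc n) \<Longrightarrow> m \<in> E 0 \<Longrightarrow> x \<otimes> m \<in> E (Suc n)"
    and E4: "\<And>n. E (Suc n) \<inter> E 0 = {}"
    and E5: "\<And>d. (\<And>n. d n \<in> E (Suc n)) \<Longrightarrow> cluster_set X d \<subseteq> E 0"
    using E by (auto simp: coset_sequence_def)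
  have M: "E 0 \<subseteq> carrier G"
    using sub by (rule subgroup.subset)
  obtain V where V: "nbhd_chain V" "V 0 = carrier G" "\<And>n. V (Suc n) \<subseteq> carrier G - {x}"
  proof (rule nbhd_chain_below[of "\<lambda>n. carrier G - {x}"])
    fix n
    show "openin X (carrier G - {x}) \<and> \<one> \<in> carrier G - {x}"
      using t1 t1_space_openin_delete_alt[of X] openin_topspace[of X] x(2)
      by (auto simp: topspace_eq)
  qed (rule that)
  \<comment> \<open>Picking \<open>d n\<close> as deep in the chain as \<open>E (Suc n)\<close> and \<open>n\<close> allow puts almost all \<open>d n\<close> into each \<open>V k\<close>.\<close>
  define \<kappa> where "\<kappa> n = Max {k. k \<le> n \<and> E (Suc n) \<inter> V k \<noteq> {}}" for n
  have fin: "finite {k. k \<le> n \<and> E (Suc n) \<inter> V k \<noteq> {}}" for n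
    by simp
  have "E (Suc n) \<inter> V (\<kappa> n) \<noteq> {}" for n
  proof -
    \<comment> \<open>As \<open>V 0\<close> is the whole group, level 0 is always available and the
      maximum \<open>\<kappa> n\<close> is taken over a nonempty set.\<close>
    have "E (Suc n) \<inter> V 0 \<noteq> {}"
      using E2(2)[of "Suc n"] closedin_subset[OF E2(1), of "Suc n"] V(2) by (auto simp: topspace_eq)
    then have "0 \<in> {k. k \<le> n \<and> E (Suc n) \<inter> V k \<noteq> {}}"
      by simp
    then show ?thesis
      using Max_in[OF fin, of n] unfolding \<kappa>_def by blast
  qed
  then have "\<forall>n. \<exists>y. y \<in> E (Suc n) \<inter> V (\<kappa> n)"
    by blast
  then obtain d where d: "\<And>n. d n \<in> E (Suc n)" "\<And>n. d n \<in> V (\<kappa> n)"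
    by (metis IntD1 IntD2)
  have ev: "\<exists>N. \<forall>n\<ge>N. d n \<in> V k" for k
  proof -
    obtain N where N: "\<forall>n\<ge>N. E (Suc n) \<inter> V k \<noteq> {}"
      using coset_sequence_meets_nbhd[OF Q E openin_nbhd_chain[OF V(1)] one_in_nbhd_chain[OF V(1)]] by blast
    have "d n \<in> V k" if "n \<ge> max N k" for n
    proof -
      have "k \<le> \<kappa> n"
        unfolding \<kappa>_def using N that by (intro Max_ge[OF fin]) auto
      then show ?thesis
        using subsetD[OF nbhd_chain_antimono[OF V(1)] d(2)] by simp
    qed
    then show ?thesis
      by blast
  qed
  let ?E = "case_nat (E 0 \<inter> (\<Inter>k. V k)) (\<lambda>n. (\<lambda>m. d n \<otimes> m) ` (E 0 \<inter> (\<Inter>k. V k)))"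
  have "coset_sequence Q ?E"
    using Q sub E2(1,3,3) E3 E5 V(1) d(1) ev
  proof (rule coset_sequence_refinement[where W = "\<lambda>n. E (Suc n)"])
    show "d n \<notin> E 0 \<inter> (\<Inter>k. V k)" for n
      using d(1)[of n] E4[of n] by blast
  qed
  moreover have "?E \<le> E"
  proof (rule le_funI)
    show "?E n \<le> E n" for n
      using E3[OF d(1)] by (cases n) auto
  qed
  moreover have "x \<notin> ?E 0"
    using V(3)[of 0] by auto
  ultimately show thesis
    by (rule that)
qed

lemma compact_subgroup_convergent_sequence:
  assumes Q: "compactin X Q" "subgroup Q G" "infinite Q"
  obtains d where "\<And>n. d n \<in> Q - {\<one>}" "cluster_set X d \<subseteq> {\<one>}"
proof -
  define A where "A = Collect (coset_sequence Q)"
  \<comment> \<open>The order is reversed, so that a maximal element for \<open>R\<close> is a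
    minimal coset sequence.\<close>
  define R where "R E E' = (E' \<le> E)" for E E' :: "nat \<Rightarrow> 'a set"
  have "\<exists>E\<in>A. \<forall>E'\<in>A. R E E' \<longrightarrow> E' = E"
  proof (rule predicate_Zorn)
    show "partial_order_on A (relation_of R A)"
      by (rule partial_order_on_relation_ofI) (auto simp: R_def)
  next
    fix C
    assume C: "C \<in> Chains (relation_of R A)"
    then have CA: "C \<subseteq> A" and chain: "\<And>E E'. E \<in> C \<Longrightarrow> E' \<in> C \<Longrightarrow> E \<le> E' \<or> E' \<le> E"
      by (auto simp: Chains_def relation_of_def R_def)
    show "\<exists>u\<in>A. \<forall>a\<in>C. R a u"
    proof (cases "C = {}")
      \<comment> \<open>The intersection over an empty chain would be the whole type, so here any
        coset sequence serves as the bound.\<close>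
      case True
      then show ?thesis
        using coset_sequence_exists[OF Q] by (auto simp: A_def)
    next
      case False
      have "coset_sequence Q (\<lambda>n. \<Inter>E\<in>C. E n)"
        using Q(1) False _ chain by (rule coset_sequence_Inter) (use CA in \<open>auto simp: A_def\<close>)
      then show ?thesis
        by (intro bexI[of _ "\<lambda>n. \<Inter>E\<in>C. E n"]) (auto simp: A_def R_def le_fun_def)
    qed
  qed
  then obtain E where E: "coset_sequence Q E"
    and min: "\<And>E'. coset_sequence Q E' \<Longrightarrow> E' \<le> E \<Longrightarrow> E' = E"
    by (auto simp: A_def R_def)
  have E2: "\<And>n. E n \<noteq> {}" "\<And>n. E n \<subseteq> Q" "\<one> \<in> E 0"
    and E4: "\<And>n. E (Suc n) \<inter> E 0 = {}"
    and E5: "\<And>d. (\<And>n. d n \<in> E (Suc n)) \<Longrightarrow> cluster_set X d \<subseteq> E 0"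
    using E by (auto simp: coset_sequence_def intro: subgroup.one_closed)
  \<comment> \<open>Any further point of \<open>E 0\<close> could be removed by another refinement,
    contradicting minimality.\<close>
  have "E 0 \<subseteq> {\<one>}"
  proof
    fix x
    assume x: "x \<in> E 0"
    show "x \<in> {\<one>}"
    proof (rule ccontr)
      assume "x \<notin> {\<one>}"
      then have "x \<noteq> \<one>"
        by simp
      obtain E' where "coset_sequence Q E'" "E' \<le> E" "x \<notin> E' 0"
        using Q(1) E x \<open>x \<noteq> \<one>\<close> by (rule coset_sequence_not_minimal)
      then show False
        using min x by blast
    qed
  qed
  have "\<forall>n. \<exists>x. x \<in> E (Suc n)"
    using E2(1) by blast
  then obtain d where d: "\<And>n. d n \<in> E (Suc n)"
    by metis
  show thesis
  proof (rule that[of d])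
    show "d n \<in> Q - {\<one>}" for n
      using d[of n] E2(2)[of "Suc n"] E2(3) E4[of n] by auto
    show "cluster_set X d \<subseteq> {\<one>}"
      using E5[of d] d \<open>E 0 \<subseteq> {\<one>}\<close> by blast
  qed
qed

subsection \<open>Metrizability\<close>

lemma one_eq_nbhd_chain_Inter:
  assumes hn: "hereditarily normal_space X"
    and V: "nbhd_chain V" and Q: "compactin X (\<Inter>n. V n)"
  obtains W where "nbhd_chain W" "(\<Inter>n. W n) = {\<one>}"
proof (cases "finite (\<Inter>n. V n)")
  case True
  define S where "S = (\<Inter>n. V n) - {\<one>}"
  have "finite S"
    using True by (simp add: S_def)
  moreover have "S \<subseteq> topspace X"
    using nbhd_chain_subset_carrier[OF V, of 0] by (auto simp: S_def topspace_eq)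
  ultimately have "closedin X S"
    using t1 by (simp add: t1_space_closedin_finite)
  then have S: "openin X (carrier G - S)"
    by (simp add: closedin_def topspace_eq)
  \<comment> \<open>When the intersection is finite, deleting its finitely many points other than
    \<open>\<one>\<close> from the members leaves an open neighbourhood at each stage.\<close>
  obtain W where W: "nbhd_chain W" "\<And>n. W (Suc n) \<subseteq> V n \<inter> (carrier G - S)"
  proof (rule nbhd_chain_below[of "\<lambda>n. V n \<inter> (carrier G - S)"])
    fix n
    show "openin X (V n \<inter> (carrier G - S)) \<and> \<one> \<in> V n \<inter> (carrier G - S)"
      using openin_Int[OF openin_nbhd_chain[OF V] S] one_in_nbhd_chain[OF V] by (simp add: S_def)
  qed (rule that)
  have "x = \<one>" if "x \<in> (\<Inter>n. W n)" for x
  proof -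
    have "x \<in> V n \<inter> (carrier G - S)" for n
      using that W(2)[of n] by auto
    then show ?thesis
      by (auto simp: S_def)
  qed
  then have "(\<Inter>n. W n) = {\<one>}"
    using one_in_nbhd_chain[OF W(1)] by auto
  with W(1) show thesis
    by (rule that)
next
  case False
  obtain d where d: "\<And>n. d n \<in> (\<Inter>n. V n) - {\<one>}" and lim: "cluster_set X d \<subseteq> {\<one>}"
    using compact_subgroup_convergent_sequence[OF Q subgroup_nbhd_chain_Inter[OF V] False] by blast
  have dG: "d n \<in> carrier G - {\<one>}" for n
    using d[of n] nbhd_chain_subset_carrier[OF V, of 0] by auto
  have "cluster_set X d \<noteq> {}"
    using cluster_set_nonempty[of X _ d, OF Q closedin_nbhd_chain_Inter[OF V]] d by blast
  with lim have lim: "cluster_set X d = {\<one>}"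
    by blast
  \<comment> \<open>Stage \<open>n\<close> omits \<open>d n\<close>, so the whole sequence stays
    outside the subgroup \<open>P\<close>, while its only cluster point \<open>\<one>\<close> lies
    in \<open>P\<close>.\<close>
  obtain V' where V': "nbhd_chain V'" "\<And>n. V' (Suc n) \<subseteq> carrier G - {d n}"
  proof (rule nbhd_chain_below[of "\<lambda>n. carrier G - {d n}"])
    fix n
    show "openin X (carrier G - {d n}) \<and> \<one> \<in> carrier G - {d n}"
      using dG[of n] t1 t1_space_openin_delete_alt[of X] openin_topspace[of X]
      by (auto simp: topspace_eq)
  qed (rule that)
  define P where "P = (\<Inter>n. V' n)"
  have P: "subgroup P G" "closedin X P"
    unfolding P_def using subgroup_nbhd_chain_Inter[OF V'(1)] closedin_nbhd_chain_Inter[OF V'(1)] .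
  have dP: "d n \<in> carrier G - P" for n
    using dG[of n] V'(2)[of n] by (auto simp: P_def)
  have "cluster_set X d \<subseteq> P"
    unfolding lim using subgroup.one_closed[OF P(1)] by simp
  then obtain U :: "nat \<Rightarrow> 'a set" where U: "\<And>n. openin X (U n) \<and> \<one> \<in> U n"
    and UL: "\<And>x l. x \<in> P \<inter> (\<Inter>n. U n) \<Longrightarrow> l \<in> cluster_set X d \<Longrightarrow> x \<otimes> l \<in> cluster_set X d"
    by (rule translates_of_cluster_set[OF hn P dP]) (rule that)
  obtain W where W: "nbhd_chain W" "\<And>n. W (Suc n) \<subseteq> V' n \<inter> U n"
  proof (rule nbhd_chain_below[of "\<lambda>n. V' n \<inter> U n"])
    fix n
    show "openin X (V' n \<inter> U n) \<and> \<one> \<in> V' n \<inter> U n"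
      using U openin_nbhd_chain[OF V'(1)] one_in_nbhd_chain[OF V'(1)] by auto
  qed (rule that)
  have "x = \<one>" if x: "x \<in> (\<Inter>n. W n)" for x
  proof -
    have "x \<in> V' n \<inter> U n" for n
      using x W(2)[of n] by auto
    then have "x \<in> P \<inter> (\<Inter>n. U n)"
      by (auto simp: P_def)
    then have "x \<otimes> \<one> \<in> {\<one>}" "x \<in> carrier G"
      using UL[of x \<one>] lim subgroup.mem_carrier[OF P(1)] by auto
    then show ?thesis
      by simp
  qed
  then have "(\<Inter>n. W n) = {\<one>}"
    using one_in_nbhd_chain[OF W(1)] by auto
  with W(1) show thesis
    by (rule that)
qed

text \<open>Finitely many left translates of each chain member cover \<open>K\<close>. Their Urysohn
  functions separate the points of \<open>K\<close> because the chain shrinks to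
  \<open>\<one>\<close>, and compactness turns the resulting continuous injection into an
  embedding.\<close>

lemma metrizable_compact_subspace:
  assumes normal: "normal_space X"
    and V: "nbhd_chain V" "(\<Inter>n. V n) = {\<one>}" and K: "compactin X K"
  shows "metrizable_space (subtopology X K)"
proof -
  have KG: "K \<subseteq> carrier G"
    using compactin_subset_topspace[OF K] by (simp add: topspace_eq)
  define B where "B n c = {x \<in> carrier G. inv c \<otimes> x \<in> V n}" for n c
  have opB: "openin X (B n c)" if "c \<in> K" for n c
    unfolding B_def using that KG openin_left_translation_vimage[OF _ openin_nbhd_chain[OF V(1)]]
    by auto
  have cB: "c \<in> B n c" if "c \<in> K" for n c
    using that KG one_in_nbhd_chain[OF V(1)] by (auto simp: B_def)
  have BG: "B n c \<subseteq> topspace X" for n c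
    by (auto simp: B_def topspace_eq)
  have "\<exists>F. finite F \<and> F \<subseteq> K \<and> K \<subseteq> (\<Union>c\<in>F. B n c)" for n
  proof -
    have "\<forall>U\<in>B n ` K. openin X U" "K \<subseteq> \<Union>(B n ` K)"
      using opB cB by blast+
    then obtain \<F> where "finite \<F>" "\<F> \<subseteq> B n ` K" "K \<subseteq> \<Union>\<F>"
      using K unfolding compactin_def by meson
    then show ?thesis
      by (metis finite_subset_image)
  qed
  then obtain F where F: "\<And>n. finite (F n)" "\<And>n. F n \<subseteq> K" "\<And>n. K \<subseteq> (\<Union>c\<in>F n. B n c)"
    by metis
  \<comment> \<open>The double successor pays for two losses: one level separates the closure of
    \<open>B (Suc (Suc n)) c\<close> from the complement of \<open>B (Suc n) c\<close>, the other
    puts a quotient of elements of \<open>V (Suc n)\<close> into \<open>V n\<close>.\<close>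
  define I where "I = (SIGMA n:UNIV. F (Suc (Suc n)))"
  have Urysohn: "\<exists>f. continuous_map X euclideanreal f \<and>
      (\<forall>x\<in>B (Suc (Suc n)) c. f x = 0) \<and> (\<forall>x\<in>carrier G - B (Suc n) c. f x = 1)"
    if c: "c \<in> K" for n c
  proof -
    have "X closure_of B (Suc (Suc n)) c \<subseteq> B (Suc n) c"
    proof
      fix x
      assume x: "x \<in> X closure_of B (Suc (Suc n)) c"
      then have "x \<in> carrier G"
        using subsetD[OF closure_of_subset_topspace] topspace_eq by metis
      moreover have "inv c \<otimes> x \<in> V (Suc n)"
        using closure_of_translate_nbhd_chain[OF V(1) _ x[unfolded B_def]] c KG by auto
      ultimately show "x \<in> B (Suc n) c"
        by (simp add: B_def)
    qed
    then have "disjnt (X closure_of B (Suc (Suc n)) c) (topspace X - B (Suc n) c)"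
      by (auto simp: disjnt_iff)
    then obtain f :: "'a \<Rightarrow> real" where f: "continuous_map X (top_of_set {0..1}) f"
        "f ` (X closure_of B (Suc (Suc n)) c) \<subseteq> {0}" "f ` (topspace X - B (Suc n) c) \<subseteq> {1}"
      using Urysohn_lemma[OF normal closedin_closure_of
          closedin_diff[OF closedin_topspace opB[OF c]], of _ _ 0 1] by auto
    then have "\<forall>x\<in>B (Suc (Suc n)) c. f x = 0" "\<forall>x\<in>carrier G - B (Suc n) c. f x = 1"
      using closure_of_subset[OF BG, of "Suc (Suc n)" c] by (auto simp: topspace_eq image_subset_iff)
    moreover have "continuous_map X euclideanreal f"
      using f(1) by (simp add: continuous_map_in_subtopology)
    ultimately show ?thesis
      by blast
  qed
  have "\<exists>f. continuous_map X euclideanreal f \<and>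
      (\<forall>x\<in>B (Suc (Suc (fst i))) (snd i). f x = 0) \<and>
      (\<forall>x\<in>carrier G - B (Suc (fst i)) (snd i). f x = 1)" if "i \<in> I" for i
    using that subsetD[OF F(2)] by (intro Urysohn) (auto simp: I_def)
  then obtain f where f: "\<And>i. i \<in> I \<Longrightarrow> continuous_map X euclideanreal (f i)"
      "\<And>i x. i \<in> I \<Longrightarrow> x \<in> B (Suc (Suc (fst i))) (snd i) \<Longrightarrow> f i x = 0"
      "\<And>i x. i \<in> I \<Longrightarrow> x \<in> carrier G - B (Suc (fst i)) (snd i) \<Longrightarrow> f i x = 1"
    by metis
  define g where "g x = (\<lambda>i\<in>I. f i x)" for x
  have "continuous_map (subtopology X K) (product_topology (\<lambda>i. euclideanreal) I) g"
    unfolding g_def continuous_map_componentwise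
    using continuous_map_from_subtopology[OF f(1)] by (simp add: image_subset_iff)
  moreover have "inj_on g (topspace (subtopology X K))"
  proof (rule inj_onI)
    fix x y
    assume "x \<in> topspace (subtopology X K)" "y \<in> topspace (subtopology X K)" and gxy: "g x = g y"
    then have xy: "x \<in> K" "y \<in> K" "x \<in> carrier G" "y \<in> carrier G"
      using KG by auto
    \<comment> \<open>With \<open>c\<close> a centre whose translate contains \<open>x\<close>,
      equal values force \<open>f (n, c) y = 0\<close>, so \<open>y\<close> cannot lie outside
      \<open>B (Suc n) c\<close>.\<close>
    have "inv x \<otimes> y \<in> V n" for n
    proof -
      obtain c where c: "c \<in> F (Suc (Suc n))" "x \<in> B (Suc (Suc n)) c"
        using F(3) xy(1) by blast
      then have i: "(n, c) \<in> I" and cG: "c \<in> carrier G"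
        using subsetD[OF F(2)] KG by (auto simp: I_def)
      have "f (n, c) x = 0"
        using f(2)[OF i] c(2) by simp
      then have "f (n, c) y = 0"
        using fun_cong[OF gxy, of "(n, c)"] i by (simp add: g_def)
      then have "y \<in> B (Suc n) c"
        using f(3)[OF i, of y] xy(4) by auto
      then have y: "inv c \<otimes> y \<in> V (Suc n)"
        by (simp add: B_def)
      have "inv c \<otimes> x \<in> V (Suc n)"
        using c(2) nbhd_chain_Suc_subset[OF V(1)] by (auto simp: B_def)
      then have "inv (inv c \<otimes> x) \<otimes> (inv c \<otimes> y) \<in> V n"
        using mult_in_nbhd_chain[OF V(1) inv_in_nbhd_chain[OF V(1)] y] by simp
      moreover have "c \<otimes> (inv c \<otimes> y) = y"
        using cG xy(4) m_assoc[of c "inv c" y] by simp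
      ultimately show ?thesis
        using cG xy(3,4) by (simp add: inv_mult_group m_assoc)
    qed
    then have "inv x \<otimes> y \<in> {\<one>}"
      unfolding V(2)[symmetric] by blast
    then show "x = y"
      using xy by (metis inv_closed inv_equality inv_inv singletonD)
  qed
  ultimately have "embedding_map (subtopology X K) (product_topology (\<lambda>i. euclideanreal) I) g"
    using compact_space_subtopology[OF K]
    by (intro continuous_imp_embedding_map) (simp_all add: Hausdorff_space_product_topology)
  then have "subtopology X K homeomorphic_space
      subtopology (product_topology (\<lambda>i. euclideanreal) I) (g ` topspace (subtopology X K))"
    by (rule embedding_map_imp_homeomorphic_space)
  moreover have "countable I"
    unfolding I_def using F(1) by (intro countable_SIGMA) (auto intro: countable_finite)
  then have "metrizable_space (product_topology (\<lambda>i. euclideanreal) I)"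
    by (simp add: metrizable_space_product_topology metrizable_space_euclidean)
  ultimately show ?thesis
    using homeomorphic_metrizable_space metrizable_space_subtopology by blast
qed

end

theorem theorem2p9:
  fixes G :: "('a, 'b) monoid_scheme" and X :: "'a topology" and K :: "'a set"
  assumes "topological_group G X"
    and "t1_space X"
    and "hereditarily normal_space X"
    and "compactin X K"
  shows "metrizable_space (subtopology X K)"
proof (cases "finite K")
  \<comment> \<open>A finite set has no accumulation point to start from, but a finite T1 space is
    discrete.\<close>
  case True
  have "t1_space (subtopology X K)"
    using assms(2) by (rule t1_space_subtopology)
  moreover have "finite (topspace (subtopology X K))"
    using True by simp
  ultimately show ?thesis
    using finite_t1_space_imp_discrete_topology metrizable_space_discrete_topology by metis
next
  case False
  have normal: "normal_space X"
    using assms(3) unfolding hereditarily_def by (metis order_refl subtopology_topspace)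
  interpret hausdorff_group G X
  proof (intro hausdorff_group.intro hausdorff_group_axioms.intro)
    show "group G"
      using assms(1) by (simp add: topological_group_def)
    show "Hausdorff_space X"
      using normal assms(2) by (rule normal_t1_imp_Hausdorff_space)
  qed (rule assms(1))
  obtain V where "nbhd_chain V" "compactin X (\<Inter>n. V n)"
    using assms(3,4) False by (rule compact_nbhd_chain_Inter)
  with assms(3) obtain W where "nbhd_chain W" "(\<Inter>n. W n) = {\<one>\<^bsub>G\<^esub>}"
    by (rule one_eq_nbhd_chain_Inter)
  with normal show ?thesis
    using assms(4) by (rule metrizable_compact_subspace)
qed

end
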